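(* For every $d\in\overline D$, $$P_{\mathrm{MTZ}}(d)=\Big\{x\in P_{\mathrm{AP}} : \sum_{ij\in C}x_{ij}\leq |C|-\sum_{ij\in C}d_{ij}\ \text{ for all } C\in\mathcal C_1\Big\}.$$
   Context: Let $n\ge 4$, $N=\{1,\dots,n\}$, $A=\{ij : i,j\in N,\ i\ne j\}$ (arcs of the complete directed graph), $N_1=N\setminus\{1\}$, $A_1=\{ij : i,j\in N_1,\ i\neq j\}$. $\mathcal C_1$ is the set of (simple) directed cycles with arcs in $A_1$, each of length at least 2 and identified with its set of arcs; $|C|$ is the number of arcs. $P_{\mathrm{AP}}$ is the set of $x\in[0,1]^A$ with $\sum_{j\neq i}x_{ij}=1$ and $\sum_{j\ne i}x_{ji}=1$ for all $i\in N$. $\overline D=\{d\in\mathbb R_+^{A_1} : \sum_{ij\in C}d_{ij}\le 1\ \text{for all } C\in\mathcal C_1\}$, where $\mathbb R_+$ denotes the nonnegative reals. For $d\in\overline D$, $$Q_{\mathrm{MTZ}}(d)=\{(x,u)\in P_{\mathrm{AP}}\times\mathbb R^{N_1} : u_i-u_j+d_{ij}\le 1-x_{ij}\ \text{for all } ij\in A_1\},$$ and $P_{\mathrm{MTZ}}(d)=\{x : \exists u\in\mathbb R^{N_1},\ (x,u)\in Q_{\mathrm{MTZ}}(d)\}$ is its projection onto the $x$ variables. *)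

theory Defs
  imports Complex_Main "HOL-Library.FuncSet" "Graph_Theory.Arc_Walk"
begin

(* A real vector indexed by a finite set S is an extensional function on S (an element
   of a PiE), so that distinct functions are distinct vectors and set equalities between
   polyhedra are literal. *)

definition complete_arcs :: "'a set \<Rightarrow> ('a \<times> 'a) set" where
  "complete_arcs V = {(i, j). i \<in> V \<and> j \<in> V \<and> i \<noteq> j}"

definition nodes :: "nat \<Rightarrow> nat set" where
  "nodes n = {1..n}"

definition nodes1 :: "nat \<Rightarrow> nat set" where
  "nodes1 n = nodes n - {1}"

definition arcs_A :: "nat \<Rightarrow> (nat \<times> nat) set" where
  "arcs_A n = complete_arcs (nodes n)"

definition arcs_A1 :: "nat \<Rightarrow> (nat \<times> nat) set" where
  "arcs_A1 n = complete_arcs (nodes1 n)"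

definition digraph1 :: "nat \<Rightarrow> (nat, nat \<times> nat) pre_digraph" where
  "digraph1 n = \<lparr>verts = nodes1 n, arcs = arcs_A1 n, tail = fst, head = snd\<rparr>"

definition dicycles1 :: "nat \<Rightarrow> (nat \<times> nat) set set" where
  "dicycles1 n = {set p | p. pre_digraph.cycle (digraph1 n) p \<and> 2 \<le> length p}"

definition P_AP :: "nat \<Rightarrow> (nat \<times> nat \<Rightarrow> real) set" where
  "P_AP n = {x \<in> arcs_A n \<rightarrow>\<^sub>E {0..1}.
     \<forall>i\<in>nodes n. (\<Sum>j\<in>nodes n - {i}. x (i, j)) = 1 \<and> (\<Sum>j\<in>nodes n - {i}. x (j, i)) = 1}"

definition D_bar :: "nat \<Rightarrow> (nat \<times> nat \<Rightarrow> real) set" where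
  "D_bar n = {d \<in> arcs_A1 n \<rightarrow>\<^sub>E {0..}. \<forall>C\<in>dicycles1 n. (\<Sum>a\<in>C. d a) \<le> 1}"

definition Q_MTZ :: "nat \<Rightarrow> (nat \<times> nat \<Rightarrow> real) \<Rightarrow> ((nat \<times> nat \<Rightarrow> real) \<times> (nat \<Rightarrow> real)) set" where
  "Q_MTZ n d = {(x, u) \<in> P_AP n \<times> (nodes1 n \<rightarrow>\<^sub>E UNIV).
     \<forall>(i, j)\<in>arcs_A1 n. u i - u j + d (i, j) \<le> 1 - x (i, j)}"

definition P_MTZ :: "nat \<Rightarrow> (nat \<times> nat \<Rightarrow> real) \<Rightarrow> (nat \<times> nat \<Rightarrow> real) set" where
  "P_MTZ n d = {x. \<exists>u \<in> nodes1 n \<rightarrow>\<^sub>E UNIV. (x, u) \<in> Q_MTZ n d}"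

end

theory Submission
  imports Defs "Graph_Theory.Weighted_Graph"
begin

text \<open>
  Give every arc \<open>a\<close> the weight \<open>w a = 1 - x a - d a\<close>. For fixed \<open>x\<close>, the system defining
  \<^const>\<open>Q_MTZ\<close> then reads \<open>u i - u j \<le> w (i, j)\<close>: it asks that \<open>u\<close> be a feasible potential
  for \<open>w\<close>. By the classical theorem on difference constraints such a \<open>u\<close> exists iff no
  directed cycle has negative weight (\<open>feasible_potential_iff\<close>), and the weight of a cycle \<open>C\<close>
  is \<open>|C| - (\<Sum>a\<in>C. x a) - (\<Sum>a\<in>C. d a)\<close>, so its nonnegativity is the cycle inequality of \<open>C\<close>.

  Necessity holds because the potential differences telescope to \<open>0\<close> around a cycle. For
  sufficiency the potential of \<open>u\<close> is the least cost of a simple path that starts at \<open>u\<close> and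
  may end anywhere. Leaving the end point free makes this a minimum over a finite nonempty set
  at every vertex, which takes the place of the usual shortest paths to an auxiliary root.
\<close>

section \<open>Feasible potentials\<close>

lemma (in wf_digraph) potential_difference_le_awalk_cost:
  assumes "awalk u p v"
    and "\<And>a. a \<in> arcs G \<Longrightarrow> \<pi> (tail G a) - \<pi> (head G a) \<le> w a"
  shows "\<pi> u - \<pi> v \<le> awalk_cost w p"
  using assms(1)
proof (induction p arbitrary: u)
  case Nil
  then show ?case by (simp add: awalk_Nil_iff)
next
  case (Cons a p)
  then have "a \<in> arcs G" "u = tail G a" "\<pi> (head G a) - \<pi> v \<le> awalk_cost w p"
    by (auto simp: awalk_Cons_iff)
  with assms(2)[of a] show ?case by simp
qed

text \<open>
  Prefixing a simple path with an arc into its start either gives a simple path again or closes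
  a cycle; in the second case the part of the path after that cycle is a simple path from the
  same vertex, and dropping a cycle of nonnegative weight does not increase the cost. This is
  what makes the minimum over simple paths satisfy the same inequality as the infimum over all
  walks would.
\<close>
lemma (in wf_digraph) apath_after_arc:
  assumes "a \<in> arcs G" "apath (head G a) p v"
    and nonneg: "\<And>c. cycle c \<Longrightarrow> 0 \<le> awalk_cost w c"
  obtains q where "apath (tail G a) q v" "awalk_cost w q \<le> w a + awalk_cost w p"
proof (cases "tail G a \<in> set (awalk_verts (head G a) p)")
  case False
  with assms(1,2) have "apath (tail G a) (a # p) v"
    by (simp add: apath_Cons_iff)
  then show ?thesis by (rule that) simp
next
  case True
  have "awalk (head G a) p v"
    using assms(2) by (rule awalkI_apath)
  from awalk_decomp[OF this True] obtain q r
    where p: "p = q @ r" and q: "awalk (head G a) q (tail G a)"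
    by blast
  have split: "apath (head G a) q (tail G a)" "apath (tail G a) r v"
    using assms(2) q unfolding p apath_append_iff by auto
  have "cycle (a # q)"
    using assms(1) split(1) by (auto simp: cycle_def apath_def awalk_Cons_iff)
  from nonneg[OF this] have "awalk_cost w r \<le> w a + awalk_cost w p"
    by (simp add: p)
  with split(2) show ?thesis by (rule that)
qed

lemma (in fin_digraph) finite_apaths_from: "finite {p. \<exists>v. apath u p v}"
proof (rule finite_subset)
  show "{p. \<exists>v. apath u p v} \<subseteq> (fst \<circ> snd) ` {(u, p, v). apath u p v}"
    by force
  show "finite ((fst \<circ> snd) ` {(u, p, v). apath u p v})"
    using apaths_finite_triple by blast
qed

text \<open>
  The potential of a vertex is the least cost of a simple path leaving it. Simple paths, unlike
  walks, are finite in number, so the minimum exists and is attained.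
\<close>
theorem (in fin_digraph) feasible_potential_iff:
  "(\<exists>\<pi>. \<forall>a\<in>arcs G. \<pi> (tail G a) - \<pi> (head G a) \<le> w a) \<longleftrightarrow>
    (\<forall>c. cycle c \<longrightarrow> 0 \<le> awalk_cost w c)"
proof (intro iffI allI impI)
  fix c
  assume "\<exists>\<pi>. \<forall>a\<in>arcs G. \<pi> (tail G a) - \<pi> (head G a) \<le> w a" and "cycle c"
  then show "0 \<le> awalk_cost w c"
    unfolding cycle_def by (fastforce dest: potential_difference_le_awalk_cost)
next
  assume nonneg: "\<forall>c. cycle c \<longrightarrow> 0 \<le> awalk_cost w c"
  define costs where "costs u = awalk_cost w ` {p. \<exists>v. apath u p v}" for u
  have "finite (costs u)" for u
    unfolding costs_def by (intro finite_imageI finite_apaths_from)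
  have "Min (costs (tail G a)) - Min (costs (head G a)) \<le> w a" if arc: "a \<in> arcs G" for a
  proof -
    \<comment> \<open>The empty path starts at every vertex, so the minima exist.\<close>
    have "apath (head G a) [] (head G a)"
      using arc by (simp add: apath_Nil_iff)
    then have "costs (head G a) \<noteq> {}"
      unfolding costs_def by blast
    then have "Min (costs (head G a)) \<in> costs (head G a)"
      using \<open>finite (costs (head G a))\<close> by (rule Min_in[rotated])
    then obtain p v where p: "apath (head G a) p v" "Min (costs (head G a)) = awalk_cost w p"
      unfolding costs_def by blast
    obtain q where q: "apath (tail G a) q v" "awalk_cost w q \<le> w a + awalk_cost w p"
      using apath_after_arc[OF arc p(1)] nonneg by blast
    have "Min (costs (tail G a)) \<le> awalk_cost w q"
      using \<open>finite (costs (tail G a))\<close> q(1) unfolding costs_def by (intro Min_le) auto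
    with p(2) q(2) show ?thesis by linarith
  qed
  then show "\<exists>\<pi>. \<forall>a\<in>arcs G. \<pi> (tail G a) - \<pi> (head G a) \<le> w a"
    by (intro exI[of _ "\<lambda>u. Min (costs u)"]) blast
qed

lemma (in wf_digraph) awalk_cost_cycle_eq_sum:
  assumes "cycle c"
  shows "awalk_cost w c = (\<Sum>a\<in>set c. w a)"
  using assms unfolding cycle_conv awalk_cost_def by (auto simp: sum_list_distinct_conv_sum_set)

section \<open>The arcs avoiding the first node\<close>

lemma digraph1_sel [simp]:
  "verts (digraph1 n) = nodes1 n" "arcs (digraph1 n) = arcs_A1 n"
  "tail (digraph1 n) = fst" "head (digraph1 n) = snd"
  by (simp_all add: digraph1_def)

lemma finite_nodes1: "finite (nodes1 n)"
  by (simp add: nodes1_def nodes_def)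

lemma finite_arcs_A1: "finite (arcs_A1 n)"
  by (rule finite_subset[of _ "nodes1 n \<times> nodes1 n"])
    (auto simp: arcs_A1_def complete_arcs_def finite_nodes1)

interpretation digraph1: digraph "digraph1 n" for n
  by unfold_locales
    (auto simp: finite_nodes1 finite_arcs_A1 arc_to_ends_def, auto simp: arcs_A1_def complete_arcs_def)

lemma dicycles1_eq: "dicycles1 n = set ` {c. digraph1.cycle n c}"
proof -
  \<comment> \<open>Without loops, the length condition holds for every cycle.\<close>
  have "2 \<le> length c" if "digraph1.cycle n c" for c
    using that by (auto simp: digraph1.cycle_digraph_conv)
  then show ?thesis
    unfolding dicycles1_def by auto
qed

lemma feasible_potential_A1_iff:
  fixes w :: "nat \<times> nat \<Rightarrow> real"
  shows
  "(\<exists>\<pi>. \<forall>(i, j)\<in>arcs_A1 n. \<pi> i - \<pi> j \<le> w (i, j)) \<longleftrightarrow>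
    (\<forall>C\<in>dicycles1 n. 0 \<le> (\<Sum>a\<in>C. w a))"
  using digraph1.feasible_potential_iff[of n w]
  by (auto simp: dicycles1_eq digraph1.awalk_cost_cycle_eq_sum case_prod_unfold)

text \<open>
  The inequalities read a potential only at nodes other than \<open>1\<close>, so restricting it to these
  nodes keeps them true and makes it extensional.
\<close>
lemma P_MTZ_iff_potential:
  "x \<in> P_MTZ n d \<longleftrightarrow>
    x \<in> P_AP n \<and> (\<exists>\<pi>. \<forall>(i, j)\<in>arcs_A1 n. \<pi> i - \<pi> j \<le> 1 - x (i, j) - d (i, j))"
proof
  assume "x \<in> P_MTZ n d"
  then show "x \<in> P_AP n \<and> (\<exists>\<pi>. \<forall>(i, j)\<in>arcs_A1 n. \<pi> i - \<pi> j \<le> 1 - x (i, j) - d (i, j))"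
    unfolding P_MTZ_def Q_MTZ_def by (fastforce simp: algebra_simps)
next
  assume "x \<in> P_AP n \<and> (\<exists>\<pi>. \<forall>(i, j)\<in>arcs_A1 n. \<pi> i - \<pi> j \<le> 1 - x (i, j) - d (i, j))"
  then obtain \<pi> where x: "x \<in> P_AP n"
    and \<pi>: "\<And>i j. (i, j) \<in> arcs_A1 n \<Longrightarrow> \<pi> i - \<pi> j \<le> 1 - x (i, j) - d (i, j)"
    by blast
  define u where "u = restrict \<pi> (nodes1 n)"
  have "u i - u j + d (i, j) \<le> 1 - x (i, j)" if "(i, j) \<in> arcs_A1 n" for i j
    using \<pi>[OF that] that by (simp add: u_def arcs_A1_def complete_arcs_def)
  moreover have "u \<in> nodes1 n \<rightarrow>\<^sub>E UNIV"
    by (simp add: u_def)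
  ultimately show "x \<in> P_MTZ n d"
    using x unfolding P_MTZ_def Q_MTZ_def by blast
qed

section \<open>The projection\<close>

theorem proposition12:
  fixes n :: nat and d :: "nat \<times> nat \<Rightarrow> real"
  assumes "n \<ge> 4" and "d \<in> D_bar n"
  shows "P_MTZ n d =
    {x \<in> P_AP n. \<forall>C\<in>dicycles1 n. (\<Sum>a\<in>C. x a) \<le> real (card C) - (\<Sum>a\<in>C. d a)}"
proof (rule set_eqI)
  fix x
  have weight: "0 \<le> (\<Sum>a\<in>C. 1 - x a - d a) \<longleftrightarrow>
      (\<Sum>a\<in>C. x a) \<le> real (card C) - (\<Sum>a\<in>C. d a)" for C
    by (simp add: sum_subtractf) linarith
  show "x \<in> P_MTZ n d \<longleftrightarrow>
      x \<in> {x \<in> P_AP n. \<forall>C\<in>dicycles1 n. (\<Sum>a\<in>C. x a) \<le> real (card C) - (\<Sum>a\<in>C. d a)}"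
    using feasible_potential_A1_iff[of n "\<lambda>a. 1 - x a - d a"]
    by (simp add: P_MTZ_iff_potential weight)
qed

end
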